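(* Let $q=2^h$, let $\alpha\in{\rm GF}(q)$ be such that $X^2+X+\alpha$ is irreducible over ${\rm GF}(q)$, and let $G=\{M_{a,b,c,d}: a\in{\rm GF}(q)\setminus\{0\},\ b,c,d\in{\rm GF}(q),\ c^2+cd+\alpha d^2=1\}$, where $$M_{a,b,c,d}=\begin{pmatrix}1&0&0&0&0\\0&ac&\alpha ad&bc&\alpha bd\\0&ad&a(c+d)&bd&b(c+d)\\0&0&0&a^{-1}c&\alpha a^{-1}d\\0&0&0&a^{-1}d&a^{-1}(c+d)\end{pmatrix},$$ acting on the points (column vectors) of ${\rm PG}(4,q)$ by left multiplication. Then, under the action of $G$ on the planes of ${\rm PG}(4,q)$, there are $q^2-q$ distinct plane-orbits of size $q^3-q$, each consisting of planes any two of which intersect in exactly one point. *)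

theory Defs
  imports "HOL-Analysis.Analysis" "HOL-Computational_Algebra.Polynomial"
begin

text \<open>Points of PG(4,q) are 1-dimensional subspaces of GF(q)^5, planes are
3-dimensional subspaces of GF(q)^5 (vectors are columns, type 'a^5).\<close>

definition pg4_planes :: "('a::field ^ 5) set set" where
  "pg4_planes = {S. vec.subspace S \<and> vec.dim S = 3}"

definition M_abcd :: "'a::field \<Rightarrow> 'a \<Rightarrow> 'a \<Rightarrow> 'a \<Rightarrow> 'a \<Rightarrow> 'a ^ 5 ^ 5" where
  "M_abcd \<alpha> a b c d = vector [
     vector [1, 0, 0, 0, 0],
     vector [0, a * c, \<alpha> * a * d, b * c, \<alpha> * b * d],
     vector [0, a * d, a * (c + d), b * d, b * (c + d)],
     vector [0, 0, 0, inverse a * c, \<alpha> * inverse a * d],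
     vector [0, 0, 0, inverse a * d, inverse a * (c + d)]]"

definition groupG :: "'a::field \<Rightarrow> ('a ^ 5 ^ 5) set" where
  "groupG \<alpha> = {M_abcd \<alpha> a b c d | a b c d. a \<noteq> 0 \<and> c^2 + c * d + \<alpha> * d^2 = 1}"

text \<open>Image of a plane under a matrix acting on column vectors by left multiplication.\<close>
definition plane_image :: "'a::field ^ 5 ^ 5 \<Rightarrow> ('a ^ 5) set \<Rightarrow> ('a ^ 5) set" where
  "plane_image M S = (\<lambda>v. M *v v) ` S"

definition plane_orbit :: "('a::field ^ 5 ^ 5) set \<Rightarrow> ('a ^ 5) set \<Rightarrow> ('a ^ 5) set set" where
  "plane_orbit G S = {plane_image M S | M. M \<in> G}"

definition plane_orbits :: "('a::field ^ 5 ^ 5) set \<Rightarrow> ('a ^ 5) set set set" where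
  "plane_orbits G = {plane_orbit G S | S. S \<in> pg4_planes}"

text \<open>Two planes meet in exactly one point of PG(4,q): their intersection
(as subspaces) is 1-dimensional.\<close>
definition meet_in_one_point :: "('a::field ^ 5) set \<Rightarrow> ('a ^ 5) set \<Rightarrow> bool" where
  "meet_in_one_point S T \<longleftrightarrow> vec.dim (S \<inter> T) = 1"

end

theory Submission
  imports Defs "HOL-Number_Theory.Residues"
begin

(*
  Identify GF(q)^2 with K = GF(q^2) = GF(q)(\<omega>), \<omega>^2 = \<omega> + \<alpha>, via (x1, x2) \<mapsto> x1 + x2 \<omega>.
  Then c^2 + cd + \<alpha>d^2 is the norm N(u) of u = c + d\<omega>, and M_{a,b,c,d} acts on a point
  (x, z, v) of GF(q) \<times> K \<times> K as (x, z, v) \<mapsto> (x, auz + buv, a^-1 uv). It maps the plane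
  z = xw + conj v to the plane z = x(au)w + ab v + (au)^2 conj v. Two such images with
  (ab, au) \<noteq> (a'b', a'u') meet in the kernel of the GF(q)-linear map
  (x, v) \<mapsto> x\<delta>w + ev + \<delta>^2 conj v, where \<delta> = au - a'u' and e = ab - a'b'. If w \<notin> GF(q)
  this map GF(q) \<times> K \<rightarrow> K is onto: for e \<noteq> N(\<delta>) already v \<mapsto> ev + \<delta>^2 conj v is invertible,
  and for e = N(\<delta>) it is v \<mapsto> \<delta> Tr(conj \<delta> v), whose image \<delta>GF(q) does not contain x\<delta>w
  for x \<noteq> 0. So each orbit consists of |G| = q^3 - q planes pairwise meeting in a point,
  and the q^2 - q choices of w give distinct orbits. In coordinates, surjectivity is the
  nonvanishing of the cross product of the two rows of this map.
*)

section \<open>Characteristic 2\<close>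

lemma two_eq_zero_if_CARD_eq_power_2:
  assumes "CARD('a::{finite,field}) = 2 ^ h"
  shows "(2::'a) = 0"
proof -
  have prime: "prime CHAR('a)"
    by (rule prime_CHAR_semidom) (simp add: finite_imp_CHAR_pos)
  have "CHAR('a) dvd 2 ^ h"
    using CHAR_dvd_CARD[where 'a='a] assms by simp
  then have "CHAR('a) dvd 2"
    using prime prime_dvd_power by blast
  then have "CHAR('a) = 2"
    using prime two_is_prime_nat primes_dvd_imp_eq by blast
  then show ?thesis
    by (metis of_nat_CHAR of_nat_numeral)
qed

lemma char2_add_self: "(2::'a::ring_1) = 0 \<Longrightarrow> x + x = (0::'a)"
  by (metis mult_2 mult_zero_left)

lemma char2_add_self_left: "(2::'a::ring_1) = 0 \<Longrightarrow> x + (x + y) = (y::'a)"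
  by (metis add.assoc add_0 char2_add_self)

lemma char2_uminus: "(2::'a::ring_1) = 0 \<Longrightarrow> - x = (x::'a)"
  by (metis add_eq_0_iff char2_add_self)

lemma char2_diff: "(2::'a::ring_1) = 0 \<Longrightarrow> x - y = (x + y::'a)"
  by (metis char2_uminus diff_conv_add_uminus)

lemma char2_numeral_Bit0: "(2::'a::ring_1) = 0 \<Longrightarrow> (numeral (Num.Bit0 n) :: 'a) = 0"
  by (simp only: numeral_Bit0 char2_add_self)

lemma char2_numeral_Bit1: "(2::'a::ring_1) = 0 \<Longrightarrow> (numeral (Num.Bit1 n) :: 'a) = 1"
  by (simp only: numeral_Bit1 char2_add_self add_0)

lemmas char2_simps = char2_add_self char2_add_self_left char2_uminus char2_diff
  char2_numeral_Bit0 char2_numeral_Bit1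

lemma char2_power2_add:
  assumes "(2::'a::comm_ring_1) = 0"
  shows "(x + y)^2 = x^2 + (y::'a)^2"
  by (simp add: char2_simps[OF assms] power2_eq_square algebra_simps)

lemma char2_power2_eq_iff:
  assumes "(2::'a::field) = 0"
  shows "x^2 = y^2 \<longleftrightarrow> x = (y::'a)"
proof -
  have "(x - y)^2 = x^2 - y^2"
    by (simp add: char2_diff[OF assms] char2_power2_add[OF assms])
  then show ?thesis
    by auto
qed

lemma char2_surj_power2:
  assumes "(2::'a::{finite,field}) = 0"
  shows "surj (\<lambda>x::'a. x^2)"
  by (simp add: finite_UNIV_inj_surj inj_def char2_power2_eq_iff[OF assms])

section \<open>The norm form of GF(q^2) over GF(q)\<close>

abbreviation norm_form :: "'a::comm_ring_1 \<Rightarrow> 'a \<Rightarrow> 'a \<Rightarrow> 'a" where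
  "norm_form \<alpha> c d \<equiv> c^2 + c*d + \<alpha>*d^2"

lemma norm_form_scale: "norm_form \<alpha> (l*c) (l*d) = l^2 * norm_form \<alpha> c d"
  by (simp add: algebra_simps power2_eq_square)

lemma norm_form_eq_0_iff:
  fixes \<alpha> :: "'a::field"
  assumes "irreducible [:\<alpha>, 1, 1:]"
  shows "norm_form \<alpha> x y = 0 \<longleftrightarrow> x = 0 \<and> y = 0"
proof (cases "y = 0")
  case False
  have "norm_form \<alpha> x y = y^2 * poly [:\<alpha>, 1, 1:] (x / y)"
    using False by (simp add: field_simps power2_eq_square)
  then show ?thesis
    using False root_imp_reducible_poly[of "[:\<alpha>, 1, 1:]" "x / y"] assms by auto
qed simp

lemma bij_betw_scale_norm_form_eq_1:
  fixes \<alpha> :: "'a::{finite,field}"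
  assumes two: "(2::'a) = 0" and irr: "irreducible [:\<alpha>, 1, 1:]"
  shows "bij_betw (\<lambda>(l, c, d). (l*c, l*d))
           ((UNIV - {0}) \<times> {(c, d). norm_form \<alpha> c d = 1}) (UNIV - {(0, 0)})"
proof (rule bij_betwI')
  fix u v :: "'a \<times> 'a \<times> 'a"
  assume "u \<in> (UNIV - {0}) \<times> {(c, d). norm_form \<alpha> c d = 1}"
    and "v \<in> (UNIV - {0}) \<times> {(c, d). norm_form \<alpha> c d = 1}"
  moreover obtain l c d l' c' d' where uv: "u = (l, c, d)" "v = (l', c', d')"
    by (metis prod.exhaust)
  ultimately have l: "l \<noteq> 0" and norm: "norm_form \<alpha> c d = 1" "norm_form \<alpha> c' d' = 1"
    by auto
  show "((\<lambda>(l, c, d). (l*c, l*d)) u = (\<lambda>(l, c, d). (l*c, l*d)) v) = (u = v)"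
  proof
    assume eq: "(\<lambda>(l, c, d). (l*c, l*d)) u = (\<lambda>(l, c, d). (l*c, l*d)) v"
    have "l^2 = norm_form \<alpha> (l*c) (l*d)"
      using norm by (simp add: norm_form_scale)
    also have "\<dots> = norm_form \<alpha> (l'*c') (l'*d')"
      using eq uv by simp
    also have "\<dots> = l'^2"
      using norm by (simp add: norm_form_scale)
    finally have "l^2 = l'^2" .
    then have "l = l'"
      using char2_power2_eq_iff[OF two] by blast
    then show "u = v"
      using eq l uv by simp
  qed simp
next
  fix u :: "'a \<times> 'a \<times> 'a"
  assume "u \<in> (UNIV - {0}) \<times> {(c, d). norm_form \<alpha> c d = 1}"
  then show "(\<lambda>(l, c, d). (l*c, l*d)) u \<in> UNIV - {(0, 0)}"
    by auto
next
  fix v :: "'a \<times> 'a" assume "v \<in> UNIV - {(0, 0)}"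
  moreover obtain x y where v: "v = (x, y)"
    by (metis prod.exhaust)
  ultimately have "norm_form \<alpha> x y \<noteq> 0"
    using norm_form_eq_0_iff[OF irr] by auto
  moreover obtain l where "l^2 = norm_form \<alpha> x y"
    using char2_surj_power2[OF two] by (metis surjD)
  ultimately have l: "l \<noteq> 0" and "norm_form \<alpha> (inverse l * x) (inverse l * y) = 1"
    by (simp_all only: norm_form_scale power_inverse) auto
  then have "(l, inverse l * x, inverse l * y) \<in> (UNIV - {0}) \<times> {(c, d). norm_form \<alpha> c d = 1}"
    by simp
  moreover have "v = (\<lambda>(l, c, d). (l*c, l*d)) (l, inverse l * x, inverse l * y)"
    using l by (simp add: v)
  ultimately show "\<exists>u \<in> (UNIV - {0}) \<times> {(c, d). norm_form \<alpha> c d = 1}. v = (\<lambda>(l, c, d). (l*c, l*d)) u"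
    by blast
qed

lemma card_norm_form_eq_1:
  fixes \<alpha> :: "'a::{finite,field}"
  assumes two: "(2::'a) = 0" and irr: "irreducible [:\<alpha>, 1, 1:]"
  shows "card {(c, d). norm_form \<alpha> c d = 1} = CARD('a) + 1"
proof -
  let ?q = "CARD('a)" and ?U = "{(c, d). norm_form \<alpha> c d = 1}"
  have "card ((UNIV - {0::'a}) \<times> ?U) = card (UNIV - {(0::'a, 0::'a)})"
    by (rule bij_betw_same_card[OF bij_betw_scale_norm_form_eq_1[OF two irr]])
  then have "(?q - 1) * card ?U = ?q * ?q - 1"
    by (simp only: card_cartesian_product card_Diff_singleton UNIV_I card_prod)
  also have "\<dots> = (?q - 1) * (?q + 1)"
    by (cases ?q) auto
  finally have "(?q - 1) * card ?U = (?q - 1) * (?q + 1)" .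
  moreover have "?q - 1 \<noteq> 0"
    using card_mono[of UNIV "{0::'a, 1}"] by simp
  ultimately show ?thesis
    using mult_left_cancel by blast
qed

section \<open>Points of PG(4,q) and the matrices M_{a,b,c,d}\<close>

lemma exhaust_5:
  fixes x :: 5
  shows "x = 1 \<or> x = 2 \<or> x = 3 \<or> x = 4 \<or> x = 5"
proof (induct x)
  case (of_int z)
  then have "z = 0 \<or> z = 1 \<or> z = 2 \<or> z = 3 \<or> z = 4"
    by fastforce
  then show ?case
    by auto
qed

lemma forall_5: "(\<forall>i::5. P i) \<longleftrightarrow> P 1 \<and> P 2 \<and> P 3 \<and> P 4 \<and> P 5"
  by (metis exhaust_5)

lemma UNIV_5: "UNIV = {1, 2, 3, 4, 5::5}"
  using exhaust_5 by auto

lemma sum_5: "sum f (UNIV::5 set) = f 1 + f 2 + f 3 + f 4 + f 5"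
  unfolding UNIV_5 by (simp add: ac_simps)

lemma vector_5 [simp]:
  "(vector [x1, x2, x3, x4, x5] :: ('a::zero)^5)$1 = x1"
  "(vector [x1, x2, x3, x4, x5] :: ('a::zero)^5)$2 = x2"
  "(vector [x1, x2, x3, x4, x5] :: ('a::zero)^5)$3 = x3"
  "(vector [x1, x2, x3, x4, x5] :: ('a::zero)^5)$4 = x4"
  "(vector [x1, x2, x3, x4, x5] :: ('a::zero)^5)$5 = x5"
  unfolding vector_def by simp_all

lemma M_abcd_mult_nth:
  "(M_abcd \<alpha> a b c d *v y)$1 = y$1"
  "(M_abcd \<alpha> a b c d *v y)$2 = a*(c*y$2 + \<alpha>*d*y$3) + b*(c*y$4 + \<alpha>*d*y$5)"
  "(M_abcd \<alpha> a b c d *v y)$3 = a*(d*y$2 + (c + d)*y$3) + b*(d*y$4 + (c + d)*y$5)"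
  "(M_abcd \<alpha> a b c d *v y)$4 = inverse a*(c*y$4 + \<alpha>*d*y$5)"
  "(M_abcd \<alpha> a b c d *v y)$5 = inverse a*(d*y$4 + (c + d)*y$5)"
  by (simp_all add: M_abcd_def matrix_vector_mult_def sum_5 algebra_simps)

lemma linear_system_2_only_trivial_solution:
  fixes p q r t x y :: "'a::field"
  assumes "p*x + q*y = 0" and "r*x + t*y = 0" and "p*t - q*r \<noteq> 0"
  shows "x = 0 \<and> y = 0"
proof -
  have "(p*t - q*r) * x = t*(p*x + q*y) - q*(r*x + t*y)"
    and "(p*t - q*r) * y = p*(r*x + t*y) - r*(p*x + q*y)"
    by (simp_all add: algebra_simps)
  then show ?thesis
    using assms by simp
qed

lemma inj_M_abcd:
  fixes \<alpha> :: "'a::field"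
  assumes two: "(2::'a) = 0" and "a \<noteq> 0" and "norm_form \<alpha> c d \<noteq> 0"
  shows "inj ((*v) (M_abcd \<alpha> a b c d))"
proof -
  have det: "c*(c + d) - \<alpha>*d*d = norm_form \<alpha> c d"
    by (simp add: char2_simps[OF two] algebra_simps power2_eq_square)
  have "y = 0" if "M_abcd \<alpha> a b c d *v y = 0" for y
  proof -
    have "y$1 = 0" "c*y$4 + \<alpha>*d*y$5 = 0" "d*y$4 + (c + d)*y$5 = 0"
      using that \<open>a \<noteq> 0\<close> M_abcd_mult_nth[of \<alpha> a b c d y] by simp_all
    then have "y$4 = 0" "y$5 = 0"
      using linear_system_2_only_trivial_solution det assms(3) by metis+
    moreover have "c*y$2 + \<alpha>*d*y$3 = 0" "d*y$2 + (c + d)*y$3 = 0"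
      using that \<open>a \<noteq> 0\<close> calculation M_abcd_mult_nth[of \<alpha> a b c d y] by simp_all
    then have "y$2 = 0" "y$3 = 0"
      using linear_system_2_only_trivial_solution det assms(3) by metis+
    ultimately show "y = 0"
      using \<open>y$1 = 0\<close> by (simp add: vec_eq_iff forall_5)
  qed
  then show ?thesis
    using vec.inj_on_iff_eq_0[OF vec.subspace_UNIV] by blast
qed

lemma plane_image_eq_if_subset:
  assumes "inj ((*v) M)" and "S \<in> pg4_planes" and "T \<in> pg4_planes"
    and "plane_image M S \<subseteq> T"
  shows "plane_image M S = T"
proof (rule vec.subspace_dim_equal)
  show "vec.subspace (plane_image M S)"
    using assms(2) vec.subspace_image by (auto simp: pg4_planes_def plane_image_def)
  have "vec.dim (plane_image M S) = vec.dim S"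
    unfolding plane_image_def
    by (rule vec.dim_image_eq[OF matrix_vector_mul_linear_gen]) (use assms(1) inj_on_subset in blast)
  then show "vec.dim T \<le> vec.dim (plane_image M S)"
    using assms(2,3) by (simp add: pg4_planes_def)
qed (use assms(3,4) in \<open>auto simp: pg4_planes_def\<close>)

section \<open>Planes that are graphs over the coordinates 1, 4, 5\<close>

definition graph_plane :: "'a::field^3 \<Rightarrow> 'a^3 \<Rightarrow> ('a^5) set" where
  "graph_plane r s = {y. y$2 = r$1*y$1 + r$2*y$4 + r$3*y$5 \<and> y$3 = s$1*y$1 + s$2*y$4 + s$3*y$5}"

lemma graph_plane_eq_range:
  "graph_plane r s =
     range ((*v) (vector [vector [1, 0, 0], r, s, vector [0, 1, 0], vector [0, 0, 1]] :: 'a::field^3^5))"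
  (is "_ = range ((*v) ?A)")
proof (rule Set.set_eqI, rule iffI)
  fix y assume "y \<in> graph_plane r s"
  then have "y = ?A *v vector [y$1, y$4, y$5]"
    by (simp add: graph_plane_def vec_eq_iff forall_5 matrix_vector_mult_def sum_3)
  then show "y \<in> range ((*v) ?A)"
    by blast
qed (auto simp: graph_plane_def matrix_vector_mult_def sum_3)

lemma graph_plane_in_pg4_planes: "graph_plane r s \<in> pg4_planes"
proof -
  let ?A = "vector [vector [1, 0, 0], r, s, vector [0, 1, 0], vector [0, 0, 1]] :: 'a::field^3^5"
  have "inj ((*v) ?A)"
    by (intro injI) (auto simp: vec_eq_iff forall_5 forall_3 matrix_vector_mult_def sum_3)
  then have "vec.dim (range ((*v) ?A)) = vec.dim (UNIV :: ('a^3) set)"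
    by (intro vec.dim_image_eq[OF matrix_vector_mul_linear_gen]) (auto intro: inj_on_subset)
  then show ?thesis
    unfolding pg4_planes_def graph_plane_eq_range
    by (simp add: vec.subspace_image card_cart_basis)
qed

lemma graph_plane_eq_iff: "graph_plane r s = graph_plane r' s' \<longleftrightarrow> r = r' \<and> s = s'"
proof
  assume eq: "graph_plane r s = graph_plane r' s'"
  have "vector [x, r$1*x + r$2*u + r$3*z, s$1*x + s$2*u + s$3*z, u, z] \<in> graph_plane r' s'"
    for x u z
    unfolding eq[symmetric] by (simp add: graph_plane_def)
  then have "r$1*x + r$2*u + r$3*z = r'$1*x + r'$2*u + r'$3*z"
    and "s$1*x + s$2*u + s$3*z = s'$1*x + s'$2*u + s'$3*z" for x u z
    by (simp_all add: graph_plane_def)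
  from this[of 1 0 0] this[of 0 1 0] this[of 0 0 1] show "r = r' \<and> s = s'"
    by (simp add: vec_eq_iff forall_3)
qed simp

definition cross_product :: "'a::comm_ring_1^3 \<Rightarrow> 'a^3 \<Rightarrow> 'a^3" where
  "cross_product r s =
     vector [r$2 * s$3 - r$3 * s$2, r$3 * s$1 - r$1 * s$3, r$1 * s$2 - r$2 * s$1]"

lemma orthogonal_to_both_eq_scaled_cross_product:
  fixes r s x :: "'a::field^3"
  assumes r: "r$1 * x$1 + r$2 * x$2 + r$3 * x$3 = 0"
    and s: "s$1 * x$1 + s$2 * x$2 + s$3 * x$3 = 0"
    and nz: "cross_product r s \<noteq> 0"
  obtains k where "x = k *s cross_product r s"
proof -
  let ?c = "cross_product r s"
    and ?rx = "r$1 * x$1 + r$2 * x$2 + r$3 * x$3" and ?sx = "s$1 * x$1 + s$2 * x$2 + s$3 * x$3"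
  \<comment> \<open>the components of x \<times> (r \<times> s) = (x \<cdot> s) r - (x \<cdot> r) s\<close>
  have "x$2 * ?c$3 - x$3 * ?c$2 = r$1 * ?sx - s$1 * ?rx"
    and "x$3 * ?c$1 - x$1 * ?c$3 = r$2 * ?sx - s$2 * ?rx"
    and "x$1 * ?c$2 - x$2 * ?c$1 = r$3 * ?sx - s$3 * ?rx"
    by (simp_all add: cross_product_def algebra_simps)
  then have "x$i * ?c$j = x$j * ?c$i" for i j
    using r s exhaust_3[of i] exhaust_3[of j] by auto
  moreover obtain i where "?c$i \<noteq> 0"
    using nz by (auto simp: vec_eq_iff)
  ultimately have "x = (x$i / ?c$i) *s ?c"
    by (simp add: vec_eq_iff field_simps)
  then show ?thesis
    using that by blast
qed

lemma graph_planes_meet_in_one_point: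
  fixes r s r' s' :: "'a::field^3"
  assumes nz: "cross_product (r - r') (s - s') \<noteq> 0"
  shows "meet_in_one_point (graph_plane r s) (graph_plane r' s')"
proof -
  let ?c = "cross_product (r - r') (s - s')" and ?P = "graph_plane r s \<inter> graph_plane r' s'"
  define p where "p = (vector [?c$1, r$1 * ?c$1 + r$2 * ?c$2 + r$3 * ?c$3,
                          s$1 * ?c$1 + s$2 * ?c$2 + s$3 * ?c$3, ?c$2, ?c$3] :: 'a^5)"
  have "p \<in> ?P"
    by (simp add: p_def graph_plane_def cross_product_def algebra_simps)
  moreover have "p \<noteq> 0"
  proof
    assume "p = 0"
    then have "p$1 = 0" "p$4 = 0" "p$5 = 0"
      by simp_all
    then show False
      using nz by (simp add: p_def vec_eq_iff forall_3)
  qed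
  moreover have "?P \<subseteq> vec.span {p}"
  proof
    fix y assume y: "y \<in> ?P"
    then have "(r - r')$1 * y$1 + (r - r')$2 * y$4 + (r - r')$3 * y$5 = 0"
      and "(s - s')$1 * y$1 + (s - s')$2 * y$4 + (s - s')$3 * y$5 = 0"
      by (auto simp: graph_plane_def algebra_simps)
    then obtain k where "vector [y$1, y$4, y$5] = k *s ?c"
      using orthogonal_to_both_eq_scaled_cross_product[OF _ _ nz, of "vector [y$1, y$4, y$5]"]
      by auto
    then have "y = k *s p"
      using y by (auto simp: p_def graph_plane_def vec_eq_iff forall_3 forall_5 algebra_simps)
    then show "y \<in> vec.span {p}"
      by (simp add: vec.span_scale vec.span_base)
  qed
  moreover have "vec.subspace ?P"
    using graph_plane_in_pg4_planes unfolding pg4_planes_def by (blast intro: vec.subspace_inter)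
  ultimately have "?P = vec.span {p}"
    using vec.span_subspace[of "{p}" ?P] by auto
  then show ?thesis
    using \<open>p \<noteq> 0\<close> by (simp add: meet_in_one_point_def)
qed

section \<open>The orbits\<close>

(*
  Reading z = (y2, y3), v = (y4, y5), w = (w1, w2) and t = (t1, t2) as elements of GF(q)(\<omega>),
  orbit_plane is the plane z = y1 t w + e v + t^2 conj v, where conj (v1, v2) = (v1 + v2, v2).
*)
definition orbit_row1 :: "'a::field \<Rightarrow> 'a \<Rightarrow> 'a \<Rightarrow> 'a \<Rightarrow> 'a \<Rightarrow> 'a \<Rightarrow> 'a^3" where
  "orbit_row1 \<alpha> w1 w2 e t1 t2 = vector [t1*w1 + \<alpha>*t2*w2, e + t1^2 + \<alpha>*t2^2, t1^2]"

definition orbit_row2 :: "'a::field \<Rightarrow> 'a \<Rightarrow> 'a \<Rightarrow> 'a \<Rightarrow> 'a \<Rightarrow> 'a \<Rightarrow> 'a^3" where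
  "orbit_row2 \<alpha> w1 w2 e t1 t2 = vector [t2*w1 + (t1 + t2)*w2, t2^2, e + t1^2 + \<alpha>*t2^2]"

definition orbit_plane :: "'a::field \<Rightarrow> 'a \<Rightarrow> 'a \<Rightarrow> 'a \<Rightarrow> 'a \<Rightarrow> 'a \<Rightarrow> ('a^5) set" where
  "orbit_plane \<alpha> w1 w2 e t1 t2 = graph_plane (orbit_row1 \<alpha> w1 w2 e t1 t2) (orbit_row2 \<alpha> w1 w2 e t1 t2)"

lemma orbit_rows_diff:
  fixes \<alpha> :: "'a::field"
  assumes two: "(2::'a) = 0"
  shows "orbit_row1 \<alpha> w1 w2 e t1 t2 - orbit_row1 \<alpha> w1 w2 e' t1' t2' =
           orbit_row1 \<alpha> w1 w2 (e - e') (t1 - t1') (t2 - t2')"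
    and "orbit_row2 \<alpha> w1 w2 e t1 t2 - orbit_row2 \<alpha> w1 w2 e' t1' t2' =
           orbit_row2 \<alpha> w1 w2 (e - e') (t1 - t1') (t2 - t2')"
  unfolding orbit_row1_def orbit_row2_def
  by (simp_all add: vec_eq_iff forall_3 char2_simps[OF two] char2_power2_add[OF two] algebra_simps)

lemma cross_product_orbit_rows_nonzero:
  fixes \<alpha> :: "'a::field"
  assumes two: "(2::'a) = 0" and irr: "irreducible [:\<alpha>, 1, 1:]"
    and "w2 \<noteq> 0" and "(e, t1, t2) \<noteq> (0, 0, 0)"
  shows "cross_product (orbit_row1 \<alpha> w1 w2 e t1 t2) (orbit_row2 \<alpha> w1 w2 e t1 t2) \<noteq> 0"
proof
  let ?c = "cross_product (orbit_row1 \<alpha> w1 w2 e t1 t2) (orbit_row2 \<alpha> w1 w2 e t1 t2)"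
    and ?N = "norm_form \<alpha> t1 t2"
  assume "?c = 0"
  moreover have "?c$1 = (e + ?N)^2"
    by (simp add: cross_product_def orbit_row1_def orbit_row2_def char2_simps[OF two]
        algebra_simps power2_eq_square)
  ultimately have "e + ?N = ?N + ?N"
    by (simp add: vec_eq_iff char2_simps[OF two])
  then have e: "e = ?N"
    by simp
  have "?c$2 = t1 * ?N * w2" and "?c$3 = t2 * ?N * w2"
    by (simp_all add: e cross_product_def orbit_row1_def orbit_row2_def char2_simps[OF two]
        algebra_simps power2_eq_square)
  with \<open>?c = 0\<close> \<open>w2 \<noteq> 0\<close> have "t1 * ?N = 0" "t2 * ?N = 0"
    by (simp_all add: vec_eq_iff)
  then have "t1 = 0" "t2 = 0"
    using norm_form_eq_0_iff[OF irr, of t1 t2] by auto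
  then show False
    using e assms(4) by simp
qed

lemma orbit_planes_meet_in_one_point:
  fixes \<alpha> :: "'a::field"
  assumes two: "(2::'a) = 0" and irr: "irreducible [:\<alpha>, 1, 1:]"
    and "w2 \<noteq> 0" and "(e, t1, t2) \<noteq> (e', t1', t2')"
  shows "meet_in_one_point (orbit_plane \<alpha> w1 w2 e t1 t2) (orbit_plane \<alpha> w1 w2 e' t1' t2')"
  unfolding orbit_plane_def
proof (rule graph_planes_meet_in_one_point)
  have "(e - e', t1 - t1', t2 - t2') \<noteq> (0, 0, 0)"
    using assms(4) by simp
  then show "cross_product (orbit_row1 \<alpha> w1 w2 e t1 t2 - orbit_row1 \<alpha> w1 w2 e' t1' t2')
      (orbit_row2 \<alpha> w1 w2 e t1 t2 - orbit_row2 \<alpha> w1 w2 e' t1' t2') \<noteq> 0"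
    unfolding orbit_rows_diff[OF two]
    by (rule cross_product_orbit_rows_nonzero[OF two irr \<open>w2 \<noteq> 0\<close>])
qed

lemma orbit_plane_eq_iff:
  fixes \<alpha> :: "'a::field"
  assumes two: "(2::'a) = 0"
  shows "orbit_plane \<alpha> w1 w2 e t1 t2 = orbit_plane \<alpha> w1' w2' e' t1' t2' \<longleftrightarrow>
           (e, t1, t2) = (e', t1', t2') \<and> t1*w1 + \<alpha>*t2*w2 = t1*w1' + \<alpha>*t2*w2'
             \<and> t2*w1 + (t1 + t2)*w2 = t2*w1' + (t1 + t2)*w2'"
proof -
  have "t1^2 = t1'^2 \<and> t2^2 = t2'^2 \<longleftrightarrow> t1 = t1' \<and> t2 = t2'"
    using char2_power2_eq_iff[OF two] by blast
  then show ?thesis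
    unfolding orbit_plane_def graph_plane_eq_iff
    by (auto simp: orbit_row1_def orbit_row2_def vec_eq_iff forall_3)
qed

lemma plane_image_M_abcd_orbit_plane:
  fixes \<alpha> :: "'a::field"
  assumes two: "(2::'a) = 0" and a: "a \<noteq> 0" and N: "norm_form \<alpha> c d = 1"
  shows "plane_image (M_abcd \<alpha> a b c d) (orbit_plane \<alpha> w1 w2 0 1 0) =
           orbit_plane \<alpha> w1 w2 (a*b) (a*c) (a*d)"
proof (rule plane_image_eq_if_subset)
  show "inj ((*v) (M_abcd \<alpha> a b c d))"
    using inj_M_abcd[OF two a] N by simp
  show "orbit_plane \<alpha> w1 w2 0 1 0 \<in> pg4_planes" "orbit_plane \<alpha> w1 w2 (a*b) (a*c) (a*d) \<in> pg4_planes"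
    by (simp_all add: orbit_plane_def graph_plane_in_pg4_planes)
  have N1: "norm_form \<alpha> c d + 1 = 0"
    using N by (simp add: char2_simps[OF two])
  show "plane_image (M_abcd \<alpha> a b c d) (orbit_plane \<alpha> w1 w2 0 1 0) \<subseteq>
          orbit_plane \<alpha> w1 w2 (a*b) (a*c) (a*d)"
  proof
    fix z assume "z \<in> plane_image (M_abcd \<alpha> a b c d) (orbit_plane \<alpha> w1 w2 0 1 0)"
    then obtain y where y: "y \<in> orbit_plane \<alpha> w1 w2 0 1 0" and z: "z = M_abcd \<alpha> a b c d *v y"
      by (auto simp: plane_image_def)
    from y have y2: "y$2 = w1*y$1 + y$4 + y$5" and y3: "y$3 = w2*y$1 + y$5"
      by (simp_all add: orbit_plane_def graph_plane_def orbit_row1_def orbit_row2_def)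
    \<comment> \<open>each defining equation holds up to a multiple of N(c, d) + 1 = N(c, d) - 1\<close>
    have "z$2 = (a*c*w1 + \<alpha>*(a*d)*w2)*z$1 + (a*b + (a*c)^2 + \<alpha>*(a*d)^2)*z$4 + (a*c)^2*z$5
                + (norm_form \<alpha> c d + 1)*a*(c*y$4 + (c + \<alpha>*d)*y$5)"
      and "z$3 = (a*d*w1 + (a*c + a*d)*w2)*z$1 + (a*d)^2*z$4 + (a*b + (a*c)^2 + \<alpha>*(a*d)^2)*z$5
                + (norm_form \<alpha> c d + 1)*a*(d*y$4 + c*y$5)"
      unfolding z M_abcd_mult_nth y2 y3 using a
      by (simp_all add: field_simps) (simp_all add: char2_simps[OF two] algebra_simps power2_eq_square)
    then show "z \<in> orbit_plane \<alpha> w1 w2 (a*b) (a*c) (a*d)"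
      by (simp add: N1 orbit_plane_def graph_plane_def orbit_row1_def orbit_row2_def)
  qed
qed

definition group_params :: "'a::field \<Rightarrow> ('a \<times> 'a \<times> 'a \<times> 'a) set" where
  "group_params \<alpha> = (UNIV - {0}) \<times> UNIV \<times> {(c, d). norm_form \<alpha> c d = 1}"

lemma groupG_eq_image: "groupG \<alpha> = (\<lambda>(a, b, c, d). M_abcd \<alpha> a b c d) ` group_params \<alpha>"
  unfolding groupG_def group_params_def by (auto simp: image_def)

lemma card_group_params:
  fixes \<alpha> :: "'a::{finite,field}"
  assumes two: "(2::'a) = 0" and irr: "irreducible [:\<alpha>, 1, 1:]"
  shows "card (group_params \<alpha>) = CARD('a)^3 - CARD('a)"
proof -
  have "card (group_params \<alpha>) = (CARD('a) - 1) * (CARD('a) * (CARD('a) + 1))"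
    by (simp add: group_params_def card_cartesian_product card_Diff_singleton
        card_norm_form_eq_1[OF two irr])
  also have "\<dots> = CARD('a)^3 - CARD('a)"
    by (cases "CARD('a)") (simp_all add: power3_eq_cube algebra_simps)
  finally show ?thesis .
qed

lemma inj_on_group_params:
  fixes \<alpha> :: "'a::field"
  assumes two: "(2::'a) = 0"
  shows "inj_on (\<lambda>(a, b, c, d). (a*b, a*c, a*d)) (group_params \<alpha>)"
proof (rule inj_onI)
  fix p p' assume "p \<in> group_params \<alpha>" and "p' \<in> group_params \<alpha>"
    and eq: "(\<lambda>(a, b, c, d). (a*b, a*c, a*d)) p = (\<lambda>(a, b, c, d). (a*b, a*c, a*d)) p'"
  moreover obtain a b c d a' b' c' d' where p: "p = (a, b, c, d)" "p' = (a', b', c', d')"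
    by (metis prod.exhaust)
  ultimately have a: "a \<noteq> 0" and N: "norm_form \<alpha> c d = 1" "norm_form \<alpha> c' d' = 1"
    and eqs: "a*b = a'*b'" "a*c = a'*c'" "a*d = a'*d'"
    by (auto simp: group_params_def)
  have "a^2 = norm_form \<alpha> (a*c) (a*d)"
    using N by (simp add: norm_form_scale)
  also have "\<dots> = norm_form \<alpha> (a'*c') (a'*d')"
    using eqs by simp
  also have "\<dots> = a'^2"
    using N by (simp add: norm_form_scale)
  finally have "a = a'"
    using char2_power2_eq_iff[OF two] by blast
  then show "p = p'"
    using a eqs p by simp
qed

lemma plane_orbit_orbit_plane:
  fixes \<alpha> :: "'a::field"
  assumes two: "(2::'a) = 0"
  shows "plane_orbit (groupG \<alpha>) (orbit_plane \<alpha> w1 w2 0 1 0) =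
           (\<lambda>(a, b, c, d). orbit_plane \<alpha> w1 w2 (a*b) (a*c) (a*d)) ` group_params \<alpha>"
proof -
  have "plane_orbit (groupG \<alpha>) S = (\<lambda>M. plane_image M S) ` groupG \<alpha>" for S
    unfolding plane_orbit_def by blast
  then have "plane_orbit (groupG \<alpha>) (orbit_plane \<alpha> w1 w2 0 1 0) =
      (\<lambda>p. plane_image ((\<lambda>(a, b, c, d). M_abcd \<alpha> a b c d) p) (orbit_plane \<alpha> w1 w2 0 1 0)) `
        group_params \<alpha>"
    unfolding groupG_eq_image image_image .
  also have "\<dots> = (\<lambda>(a, b, c, d). orbit_plane \<alpha> w1 w2 (a*b) (a*c) (a*d)) ` group_params \<alpha>"
    by (rule image_cong) (auto simp: group_params_def plane_image_M_abcd_orbit_plane[OF two])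
  finally show ?thesis .
qed

lemma orbit_plane_in_plane_orbit:
  fixes \<alpha> :: "'a::field"
  assumes two: "(2::'a) = 0"
  shows "orbit_plane \<alpha> w1 w2 0 1 0 \<in> plane_orbit (groupG \<alpha>) (orbit_plane \<alpha> w1 w2 0 1 0)"
proof -
  have "(1, 0, 1, 0) \<in> group_params \<alpha>"
    by (simp add: group_params_def)
  then show ?thesis
    unfolding plane_orbit_orbit_plane[OF two] by force
qed

lemma inj_plane_orbit:
  fixes \<alpha> :: "'a::field"
  assumes two: "(2::'a) = 0"
  shows "inj (\<lambda>(w1, w2). plane_orbit (groupG \<alpha>) (orbit_plane \<alpha> w1 w2 0 1 0))"
proof (rule injI, clarify)
  fix w1 w2 w1' w2' :: 'a
  assume "plane_orbit (groupG \<alpha>) (orbit_plane \<alpha> w1 w2 0 1 0) =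
            plane_orbit (groupG \<alpha>) (orbit_plane \<alpha> w1' w2' 0 1 0)"
  then have "orbit_plane \<alpha> w1' w2' 0 1 0 \<in> plane_orbit (groupG \<alpha>) (orbit_plane \<alpha> w1 w2 0 1 0)"
    using orbit_plane_in_plane_orbit[OF two] by simp
  then obtain a b c d where "orbit_plane \<alpha> w1' w2' 0 1 0 = orbit_plane \<alpha> w1 w2 (a*b) (a*c) (a*d)"
    unfolding plane_orbit_orbit_plane[OF two] by auto
  then show "w1 = w1' \<and> w2 = w2'"
    by (simp add: orbit_plane_eq_iff[OF two])
qed

lemma card_plane_orbit:
  fixes \<alpha> :: "'a::{finite,field}"
  assumes two: "(2::'a) = 0" and irr: "irreducible [:\<alpha>, 1, 1:]"
  shows "card (plane_orbit (groupG \<alpha>) (orbit_plane \<alpha> w1 w2 0 1 0)) = CARD('a)^3 - CARD('a)"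
proof -
  have "inj_on (\<lambda>(a, b, c, d). orbit_plane \<alpha> w1 w2 (a*b) (a*c) (a*d)) (group_params \<alpha>)"
  proof (rule inj_onI)
    fix p p' assume p: "p \<in> group_params \<alpha>" and p': "p' \<in> group_params \<alpha>"
      and "(\<lambda>(a, b, c, d). orbit_plane \<alpha> w1 w2 (a*b) (a*c) (a*d)) p =
           (\<lambda>(a, b, c, d). orbit_plane \<alpha> w1 w2 (a*b) (a*c) (a*d)) p'"
    then have "(\<lambda>(a, b, c, d). (a*b, a*c, a*d)) p = (\<lambda>(a, b, c, d). (a*b, a*c, a*d)) p'"
      by (auto simp: orbit_plane_eq_iff[OF two] split: prod.splits)
    from inj_on_group_params[OF two] this p p' show "p = p'"
      by (rule inj_onD)
  qed
  then show ?thesis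
    by (simp add: plane_orbit_orbit_plane[OF two] card_image card_group_params[OF two irr])
qed

lemma plane_orbit_pairwise_meet_in_one_point:
  fixes \<alpha> :: "'a::field"
  assumes two: "(2::'a) = 0" and irr: "irreducible [:\<alpha>, 1, 1:]" and "w2 \<noteq> 0"
    and "S \<in> plane_orbit (groupG \<alpha>) (orbit_plane \<alpha> w1 w2 0 1 0)"
    and "T \<in> plane_orbit (groupG \<alpha>) (orbit_plane \<alpha> w1 w2 0 1 0)" and "S \<noteq> T"
  shows "meet_in_one_point S T"
  using assms(4-6) unfolding plane_orbit_orbit_plane[OF two]
  by (auto intro!: orbit_planes_meet_in_one_point[OF two irr \<open>w2 \<noteq> 0\<close>])

theorem proposition3p5:
  fixes \<alpha> :: "'a::{finite, field}" and h :: nat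
  assumes q: "CARD('a) = 2 ^ h"
    and irr: "irreducible [:\<alpha>, 1, 1:]"
  shows "\<exists>Orbs. Orbs \<subseteq> plane_orbits (groupG \<alpha>)
           \<and> card Orbs = CARD('a)^2 - CARD('a)
           \<and> (\<forall>Orb\<in>Orbs. card Orb = CARD('a)^3 - CARD('a)
                 \<and> (\<forall>S\<in>Orb. \<forall>T\<in>Orb. S \<noteq> T \<longrightarrow> meet_in_one_point S T))"
proof -
  have two: "(2::'a) = 0"
    using q by (rule two_eq_zero_if_CARD_eq_power_2)
  let ?orbit = "\<lambda>(w1, w2). plane_orbit (groupG \<alpha>) (orbit_plane \<alpha> w1 w2 0 1 0)"
  let ?Orbs = "?orbit ` (UNIV \<times> (UNIV - {0}))"
  have "?Orbs \<subseteq> plane_orbits (groupG \<alpha>)"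
    by (auto simp: plane_orbits_def orbit_plane_def graph_plane_in_pg4_planes)
  moreover have "inj_on ?orbit (UNIV \<times> (UNIV - {0}))"
    using inj_plane_orbit[OF two] by (rule inj_on_subset) simp
  then have "card ?Orbs = CARD('a)^2 - CARD('a)"
    by (simp add: card_image card_cartesian_product card_Diff_singleton power2_eq_square
        diff_mult_distrib2)
  moreover have "\<forall>Orb\<in>?Orbs. card Orb = CARD('a)^3 - CARD('a)
                   \<and> (\<forall>S\<in>Orb. \<forall>T\<in>Orb. S \<noteq> T \<longrightarrow> meet_in_one_point S T)"
    using card_plane_orbit[OF two irr] plane_orbit_pairwise_meet_in_one_point[OF two irr]
    by auto
  ultimately show ?thesis
    by blast
qed

end
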